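(* Let $(S,+)$ be an abelian semigroup and let $\mathbb{F}$ be a (nonempty) multiplicative subsemigroup of $\mathbb{N}$. Then, for every $A\subseteq S$, $$\mathrm{conv}_{\mathbb{F}}(A)=\bigcup_{n\in\mathbb{F}}n^{-1}([n]A).$$
   Context: $\mathbb{N}$ denotes the set of positive integers, and an abelian semigroup is a set with a commutative associative operation $+$. For $n\in\mathbb{N}$ and $x\in S$, $nx:=x+\cdots+x$ ($n$ summands). For $A\subseteq S$ and $n\in\mathbb{N}$ put $n^{-1}A:=\{x\in S\mid nx\in A\}$ and $[n]A:=\{x_1+\cdots+x_n\mid x_1,\ldots,x_n\in A\}$. A set $A\subseteq S$ is $n$-convex if $n^{-1}([n]A)\subseteq A$. For a nonempty $\mathbb{F}\subseteq\mathbb{N}$, $A$ is $\mathbb{F}$-convex if it is $n$-convex for all $n\in\mathbb{F}$. The $\mathbb{F}$-convex hull of $A\subseteq S$ is $\mathrm{conv}_{\mathbb{F}}(A):=\bigcap\{C\mid A\subseteq C\subseteq S,\ C\text{ is }\mathbb{F}\text{-convex}\}$. A multiplicative subsemigroup of $\mathbb{N}$ is a nonempty subset closed under multiplication (not necessarily containing $1$). *)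

theory Defs
  imports Main
begin

text \<open>The library's \<open>sum_list\<close> and \<open>sum\<close> need a neutral element, which an abelian semigroup
  need not have; hence a sum of nonempty lists. The empty list, and correspondingly \<open>n = 0\<close> below,
  is a junk case: all multipliers considered are positive.\<close>

fun semigroup_sum :: "'a::ab_semigroup_add list \<Rightarrow> 'a" where
  "semigroup_sum [] = undefined"
| "semigroup_sum [x] = x"
| "semigroup_sum (x # y # xs) = x + semigroup_sum (y # xs)"

definition nat_multiple :: "nat \<Rightarrow> 'a::ab_semigroup_add \<Rightarrow> 'a" where
  "nat_multiple n x = semigroup_sum (replicate n x)"

text \<open>The set written $n^{-1}A$.\<close>
definition division_set :: "nat \<Rightarrow> 'a::ab_semigroup_add set \<Rightarrow> 'a set" where
  "division_set n A = {x. nat_multiple n x \<in> A}"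

text \<open>The $n$-fold sumset, written $[n]A$.\<close>
definition nfold_sumset :: "nat \<Rightarrow> 'a::ab_semigroup_add set \<Rightarrow> 'a set" where
  "nfold_sumset n A = {semigroup_sum xs | xs. length xs = n \<and> set xs \<subseteq> A}"

definition n_convex :: "nat \<Rightarrow> 'a::ab_semigroup_add set \<Rightarrow> bool" where
  "n_convex n A \<longleftrightarrow> division_set n (nfold_sumset n A) \<subseteq> A"

definition F_convex :: "nat set \<Rightarrow> 'a::ab_semigroup_add set \<Rightarrow> bool" where
  "F_convex F A \<longleftrightarrow> (\<forall>n\<in>F. n_convex n A)"

definition F_convex_hull :: "nat set \<Rightarrow> 'a::ab_semigroup_add set \<Rightarrow> 'a set" where
  "F_convex_hull F A = \<Inter> {C. A \<subseteq> C \<and> F_convex F C}"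

definition multiplicative_subsemigroup :: "nat set \<Rightarrow> bool" where
  "multiplicative_subsemigroup F \<longleftrightarrow>
     F \<noteq> {} \<and> F \<subseteq> {n. 0 < n} \<and> (\<forall>m\<in>F. \<forall>n\<in>F. m * n \<in> F)"

end

theory Submission
  imports Defs
begin

text \<open>
  Every \<open>F\<close>-convex superset \<open>C\<close> of \<open>A\<close> contains each \<open>n\<^sup>-\<^sup>1([n]A) \<subseteq> n\<^sup>-\<^sup>1([n]C)\<close>, so the union lies
  in the hull. For the converse it suffices that the union is itself an \<open>F\<close>-convex superset of
  \<open>A\<close>, and the only real issue is convexity.

  The key fact is that the sets \<open>n\<^sup>-\<^sup>1([n]A)\<close> grow along divisibility: if \<open>k y\<close> is a sum of \<open>k\<close>
  elements of \<open>A\<close>, then repeating that sum \<open>j\<close> times writes \<open>(j k) y\<close> as a sum of \<open>j k\<close> elements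
  of \<open>A\<close> (\<open>division_set_nfold_mult\<close>). As \<open>F\<close> is closed under products, the family indexed by \<open>F\<close>
  is therefore directed: finitely many members \<open>y\<^sub>1, \<dots>, y\<^sub>n\<close> of the union all lie in one
  \<open>m\<^sup>-\<^sup>1([m]A)\<close> with \<open>m \<in> F\<close>, the product of the individual multipliers. If now
  \<open>n x = y\<^sub>1 + \<dots> + y\<^sub>n\<close>, then \<open>(n m) x = m y\<^sub>1 + \<dots> + m y\<^sub>n\<close> is a sum of \<open>n\<close> elements of \<open>[m]A\<close>,
  that is, an element of \<open>[n m]A\<close>, and \<open>n m \<in> F\<close> puts \<open>x\<close> in the union.
\<close>

lemma semigroup_sum_Cons:
  "xs \<noteq> [] \<Longrightarrow> semigroup_sum (x # xs) = x + semigroup_sum xs"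
  by (cases xs) auto

lemma semigroup_sum_append:
  "xs \<noteq> [] \<Longrightarrow> ys \<noteq> [] \<Longrightarrow> semigroup_sum (xs @ ys) = semigroup_sum xs + semigroup_sum ys"
  by (induction xs rule: semigroup_sum.induct) (auto simp: semigroup_sum_Cons add.assoc)

lemma semigroup_sum_concat:
  assumes "xss \<noteq> []" and "[] \<notin> set xss"
  shows "semigroup_sum (concat xss) = semigroup_sum (map semigroup_sum xss)"
  using assms
  by (induction xss rule: list_nonempty_induct)
     (auto simp: semigroup_sum_append semigroup_sum_Cons neq_Nil_conv)

lemma nat_multiple_1: "nat_multiple (Suc 0) x = x"
  by (simp add: nat_multiple_def)

lemma nat_multiple_Suc: "0 < n \<Longrightarrow> nat_multiple (Suc n) x = x + nat_multiple n x"
  by (simp add: nat_multiple_def semigroup_sum_Cons)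

lemma nat_multiple_add_right:
  "0 < n \<Longrightarrow> nat_multiple n (x + y) = nat_multiple n x + nat_multiple n y"
  by (induction n rule: nat_induct_non_zero)
     (simp_all add: nat_multiple_1 nat_multiple_Suc ac_simps)

lemma nat_multiple_semigroup_sum:
  assumes "0 < n" and "xs \<noteq> []"
  shows "nat_multiple n (semigroup_sum xs) = semigroup_sum (map (nat_multiple n) xs)"
  using assms(2)
  by (induction xs rule: list_nonempty_induct)
     (simp_all add: semigroup_sum_Cons nat_multiple_add_right assms(1))

lemma nat_multiple_mult:
  assumes "0 < m" and "0 < n"
  shows "nat_multiple (m * n) x = nat_multiple m (nat_multiple n x)"
proof -
  have "replicate (m * n) x = concat (replicate m (replicate n x))"
    by (induction m) (simp_all add: replicate_add)
  then show ?thesis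
    using assms by (simp add: nat_multiple_def semigroup_sum_concat)
qed

lemma nat_multiple_in_nfold_sumset: "x \<in> A \<Longrightarrow> nat_multiple n x \<in> nfold_sumset n A"
  unfolding nat_multiple_def nfold_sumset_def
  by (intro CollectI exI[of _ "replicate n x"]) auto

lemma nfold_sumset_mono: "A \<subseteq> B \<Longrightarrow> nfold_sumset n A \<subseteq> nfold_sumset n B"
  by (auto simp: nfold_sumset_def)

lemma nfold_sumset_nfold_sumset:
  assumes "0 < m" and "0 < n"
  shows "nfold_sumset m (nfold_sumset n A) \<subseteq> nfold_sumset (m * n) A"
proof
  fix z assume "z \<in> nfold_sumset m (nfold_sumset n A)"
  then obtain ys where z: "z = semigroup_sum ys" and ys: "length ys = m" "set ys \<subseteq> nfold_sumset n A"
    by (auto simp: nfold_sumset_def)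
  from ys(2) have "\<forall>y\<in>set ys. \<exists>xs. y = semigroup_sum xs \<and> length xs = n \<and> set xs \<subseteq> A"
    by (auto simp: nfold_sumset_def)
  then obtain f where f: "\<And>y. y \<in> set ys \<Longrightarrow> y = semigroup_sum (f y) \<and> length (f y) = n \<and> set (f y) \<subseteq> A"
    by metis
  let ?xss = "map f ys"
  have "map semigroup_sum ?xss = ys"
    using f by (auto intro: map_idI simp: o_def)
  moreover have "?xss \<noteq> []" "[] \<notin> set ?xss"
    using assms ys(1) f by force+
  ultimately have "z = semigroup_sum (concat ?xss)"
    using semigroup_sum_concat[of ?xss] z by simp
  moreover have "map (length \<circ> f) ys = replicate m n"
    using f ys(1) by (auto simp: map_replicate_const[symmetric] o_def)
  then have "length (concat ?xss) = m * n"
    by (simp add: length_concat sum_list_replicate)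
  moreover have "set (concat ?xss) \<subseteq> A"
    using f by auto
  ultimately show "z \<in> nfold_sumset (m * n) A"
    unfolding nfold_sumset_def by blast
qed

text \<open>A representation of \<open>k y\<close> as a sum of \<open>k\<close> elements, repeated \<open>j\<close> times, represents
  \<open>(j k) y\<close>.\<close>
lemma division_set_nfold_mult:
  assumes "0 < j" and "0 < k"
  shows "division_set k (nfold_sumset k A) \<subseteq> division_set (j * k) (nfold_sumset (j * k) A)"
proof
  fix y assume "y \<in> division_set k (nfold_sumset k A)"
  then have "nat_multiple j (nat_multiple k y) \<in> nfold_sumset j (nfold_sumset k A)"
    by (simp add: division_set_def nat_multiple_in_nfold_sumset)
  with nfold_sumset_nfold_sumset[OF assms] show "y \<in> division_set (j * k) (nfold_sumset (j * k) A)"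
    by (auto simp: division_set_def nat_multiple_mult assms)
qed

text \<open>Directedness: the product of the multipliers of the individual elements serves them all, by
  \<open>division_set_nfold_mult\<close>. Since \<open>F\<close> may lack \<open>1\<close>, the empty set, whose product would be \<open>1\<close>,
  needs an arbitrary member of \<open>F\<close> instead.\<close>
lemma finite_subset_common_multiplier:
  assumes F: "multiplicative_subsemigroup F" and "finite Y"
    and "Y \<subseteq> (\<Union>n\<in>F. division_set n (nfold_sumset n A))"
  shows "\<exists>m\<in>F. Y \<subseteq> division_set m (nfold_sumset m A)"
  using assms(2,3)
proof (induction Y rule: finite_induct)
  case empty
  from F show ?case
    by (auto simp: multiplicative_subsemigroup_def)
next
  case (insert y Y)
  then obtain m k where m: "m \<in> F" "Y \<subseteq> division_set m (nfold_sumset m A)"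
    and k: "k \<in> F" "y \<in> division_set k (nfold_sumset k A)"
    by auto
  from F m(1) k(1) have pos: "0 < m" "0 < k" and "m * k \<in> F"
    by (auto simp: multiplicative_subsemigroup_def)
  moreover have "y \<in> division_set (m * k) (nfold_sumset (m * k) A)"
    using division_set_nfold_mult[OF pos] k(2) by blast
  moreover have "Y \<subseteq> division_set (m * k) (nfold_sumset (m * k) A)"
    using division_set_nfold_mult[OF pos(2,1)] m(2) by (simp add: mult.commute) blast
  ultimately show ?case
    by blast
qed

lemma F_convex_UN_division_set:
  assumes F: "multiplicative_subsemigroup F"
  shows "F_convex F (\<Union>n\<in>F. division_set n (nfold_sumset n A))" (is "F_convex F ?K")
  unfolding F_convex_def n_convex_def
proof (intro ballI subsetI)
  fix n x assume n: "n \<in> F" and "x \<in> division_set n (nfold_sumset n ?K)"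
  then obtain ys where ys: "nat_multiple n x = semigroup_sum ys" "length ys = n" "set ys \<subseteq> ?K"
    by (auto simp: division_set_def nfold_sumset_def)
  obtain m where m: "m \<in> F" "set ys \<subseteq> division_set m (nfold_sumset m A)"
    using finite_subset_common_multiplier[OF F _ ys(3)] by auto
  from F n m(1) have pos: "0 < n" "0 < m" and nm: "n * m \<in> F"
    by (auto simp: multiplicative_subsemigroup_def)
  from pos ys(2) have "ys \<noteq> []" by auto
  have "nat_multiple (n * m) x = nat_multiple m (nat_multiple n x)"
    using pos by (simp add: nat_multiple_mult[symmetric] mult.commute)
  also have "\<dots> = semigroup_sum (map (nat_multiple m) ys)"
    using pos \<open>ys \<noteq> []\<close> by (simp add: ys(1) nat_multiple_semigroup_sum)
  also have "\<dots> \<in> nfold_sumset n (nfold_sumset m A)"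
    unfolding nfold_sumset_def[of n]
    using ys(2) m(2) by (intro CollectI exI[of _ "map (nat_multiple m) ys"])
      (auto simp: division_set_def)
  also have "\<dots> \<subseteq> nfold_sumset (n * m) A"
    using pos by (rule nfold_sumset_nfold_sumset)
  finally show "x \<in> ?K"
    using nm by (auto simp: division_set_def)
qed

theorem corollary7:
  fixes F :: "nat set" and A :: "'a::ab_semigroup_add set"
  assumes "multiplicative_subsemigroup F"
  shows "F_convex_hull F A = (\<Union>n\<in>F. division_set n (nfold_sumset n A))"
proof
  have "A \<subseteq> (\<Union>n\<in>F. division_set n (nfold_sumset n A))"
    using assms nat_multiple_in_nfold_sumset
    by (fastforce simp: multiplicative_subsemigroup_def division_set_def)
  with F_convex_UN_division_set[OF assms]
  show "F_convex_hull F A \<subseteq> (\<Union>n\<in>F. division_set n (nfold_sumset n A))"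
    unfolding F_convex_hull_def by blast
next
  show "(\<Union>n\<in>F. division_set n (nfold_sumset n A)) \<subseteq> F_convex_hull F A"
    unfolding F_convex_hull_def
  proof (intro UN_least Inter_greatest)
    fix n C assume n: "n \<in> F" and "C \<in> {C. A \<subseteq> C \<and> F_convex F C}"
    then have "A \<subseteq> C" and "division_set n (nfold_sumset n C) \<subseteq> C"
      by (auto simp: F_convex_def n_convex_def)
    with nfold_sumset_mono[OF \<open>A \<subseteq> C\<close>, of n] show "division_set n (nfold_sumset n A) \<subseteq> C"
      by (auto simp: division_set_def)
  qed
qed

end
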